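(* Let $R$ be an associative ring in which every nil subring is nilpotent. Then $R$ is Dischinger. In particular, every left Goldie ring with identity is Dischinger.
   Context: Rings are associative and need not have an identity; subrings need not contain an identity. A subring $T$ is nil if each of its elements is nilpotent, and nilpotent if $T^k=0$ for some positive integer $k$ (every product of $k$ elements of $T$ is $0$). A ring $R$ with identity is left Goldie if it satisfies the ascending chain condition on left annihilators (of subsets of $R$) and the left module ${}_RR$ has finite uniform dimension. An element $a\in R$ is right strongly regular if $a=a^2x$ for some $x\in R$, left strongly regular if $a=ya^2$ for some $y\in R$, and strongly regular if both. $R$ is right (respectively left) Dischinger if every right (respectively left) strongly regular element of $R$ is strongly regular; $R$ is Dischinger if it is both left and right Dischinger. *)

theory Defs
  imports Main
begin

text \<open>
  The type class \<^class>\<open>ring\<close> is the class of associative rings, not necessarily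
  with identity; a ring is represented by a type of this class.  An identity is therefore
  a property of the ring, which does not exclude the zero ring.
\<close>

definition has_identity :: "'a::ring itself \<Rightarrow> bool" where
  "has_identity R \<longleftrightarrow> (\<exists>e::'a. \<forall>x. e * x = x \<and> x * e = x)"

definition is_subring :: "'a::ring set \<Rightarrow> bool" where
  "is_subring T \<longleftrightarrow> 0 \<in> T \<and> (\<forall>x\<in>T. \<forall>y\<in>T. x - y \<in> T \<and> x * y \<in> T)"

text \<open>
  Without an identity only nonempty products exist: \<open>nprod f n\<close> is the product
  \<open>f 0 * f 1 * \<dots> * f n\<close> of \<open>n + 1\<close> factors, so \<open>n\<close> below stands
  for \<open>k - 1\<close>, where \<open>k\<close> is the positive exponent of nilpotency.
\<close>

primrec nprod :: "(nat \<Rightarrow> 'a::ring) \<Rightarrow> nat \<Rightarrow> 'a" where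
  "nprod f 0 = f 0"
| "nprod f (Suc n) = nprod f n * f (Suc n)"

definition nilpotent_element :: "'a::ring \<Rightarrow> bool" where
  "nilpotent_element x \<longleftrightarrow> (\<exists>n. nprod (\<lambda>_. x) n = 0)"

definition nil_set :: "'a::ring set \<Rightarrow> bool" where
  "nil_set T \<longleftrightarrow> (\<forall>x\<in>T. nilpotent_element x)"

definition nilpotent_set :: "'a::ring set \<Rightarrow> bool" where
  "nilpotent_set T \<longleftrightarrow> (\<exists>n. \<forall>f. (\<forall>i\<le>n. f i \<in> T) \<longrightarrow> nprod f n = 0)"

definition right_strongly_regular :: "'a::ring \<Rightarrow> bool" where
  "right_strongly_regular a \<longleftrightarrow> (\<exists>x. a = a * a * x)"

definition left_strongly_regular :: "'a::ring \<Rightarrow> bool" where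
  "left_strongly_regular a \<longleftrightarrow> (\<exists>y. a = y * (a * a))"

definition strongly_regular :: "'a::ring \<Rightarrow> bool" where
  "strongly_regular a \<longleftrightarrow> right_strongly_regular a \<and> left_strongly_regular a"

definition right_dischinger :: "'a::ring itself \<Rightarrow> bool" where
  "right_dischinger R \<longleftrightarrow> (\<forall>a::'a. right_strongly_regular a \<longrightarrow> strongly_regular a)"

definition left_dischinger :: "'a::ring itself \<Rightarrow> bool" where
  "left_dischinger R \<longleftrightarrow> (\<forall>a::'a. left_strongly_regular a \<longrightarrow> strongly_regular a)"

definition dischinger :: "'a::ring itself \<Rightarrow> bool" where
  "dischinger R \<longleftrightarrow> left_dischinger R \<and> right_dischinger R"

definition left_annihilator :: "'a::ring set \<Rightarrow> 'a set" where
  "left_annihilator S = {r. \<forall>s\<in>S. r * s = 0}"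

definition acc_left_annihilators :: "'a::ring itself \<Rightarrow> bool" where
  "acc_left_annihilators R \<longleftrightarrow>
     (\<forall>A :: nat \<Rightarrow> 'a set.
        (\<forall>i. A i \<in> range left_annihilator) \<and> (\<forall>i. A i \<subseteq> A (Suc i)) \<longrightarrow>
        (\<exists>n. \<forall>m\<ge>n. A m = A n))"

text \<open>
  The submodules of the left regular module of a ring are its left ideals.
\<close>

definition left_ideal :: "'a::ring set \<Rightarrow> bool" where
  "left_ideal I \<longleftrightarrow>
     0 \<in> I \<and> (\<forall>x\<in>I. \<forall>y\<in>I. x - y \<in> I) \<and> (\<forall>r. \<forall>x\<in>I. r * x \<in> I)"

definition uniform_left_ideal :: "'a::ring set \<Rightarrow> bool" where
  "uniform_left_ideal U \<longleftrightarrow>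
     left_ideal U \<and> U \<noteq> {0} \<and>
     (\<forall>I J. left_ideal I \<and> left_ideal J \<and> I \<subseteq> U \<and> J \<subseteq> U \<and> I \<noteq> {0} \<and> J \<noteq> {0}
        \<longrightarrow> I \<inter> J \<noteq> {0})"

definition essential_left_ideal :: "'a::ring set \<Rightarrow> bool" where
  "essential_left_ideal V \<longleftrightarrow>
     left_ideal V \<and> (\<forall>I. left_ideal I \<and> I \<noteq> {0} \<longrightarrow> V \<inter> I \<noteq> {0})"

definition sum_left_ideals :: "nat \<Rightarrow> (nat \<Rightarrow> 'a::ring set) \<Rightarrow> 'a set" where
  "sum_left_ideals n U = {\<Sum>i<n. x i | x. \<forall>i<n. x i \<in> U i}"

definition independent_left_ideals :: "nat \<Rightarrow> (nat \<Rightarrow> 'a::ring set) \<Rightarrow> bool" where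
  "independent_left_ideals n U \<longleftrightarrow>
     (\<forall>x. (\<forall>i<n. x i \<in> U i) \<and> (\<Sum>i<n. x i) = 0 \<longrightarrow> (\<forall>i<n. x i = 0))"

text \<open>
  The left regular module has uniform dimension \<open>n\<close> if it has an essential submodule
  which is a direct sum of \<open>n\<close> uniform submodules.
\<close>

definition left_uniform_dim :: "'a::ring itself \<Rightarrow> nat \<Rightarrow> bool" where
  "left_uniform_dim R n \<longleftrightarrow>
     (\<exists>U :: nat \<Rightarrow> 'a set.
        (\<forall>i<n. uniform_left_ideal (U i)) \<and>
        independent_left_ideals n U \<and>
        essential_left_ideal (sum_left_ideals n U))"

text \<open>
  The notion is meant for rings with identity; the identity is a separate hypothesis.
\<close>

definition left_goldie :: "'a::ring itself \<Rightarrow> bool" where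
  "left_goldie R \<longleftrightarrow> acc_left_annihilators R \<and> (\<exists>n. left_uniform_dim R n)"

end

theory Submission
  imports Defs
begin

text \<open>
  Let \<open>a = a\<^sup>2x\<close>. Multiplying by powers of \<open>x\<close> on the right lowers powers of
  \<open>a\<close>, so \<open>a\<close> lies in \<open>Ra\<^sup>2\<close> as soon as \<open>a\<^sup>s \<in> Ra\<^sup>s\<^sup>+\<^sup>1\<close> for a
  single \<open>s \<ge> 2\<close>. The elements \<open>a - ax\<^sup>ma\<^sup>m\<close> measure how far \<open>a\<close> is from being
  left strongly regular. Let \<open>E\<^sub>0, E\<^sub>1, \<dots>\<close> be the elements
  \<open>(a - ax\<^sup>ma\<^sup>m)a\<^sup>m\<close> for a fast growing sequence of exponents \<open>m\<close>. The product
  \<open>E\<^sub>0E\<^sub>1\<dots>E\<^sub>k\<close> has the form \<open>a\<^sup>s + ra\<^sup>s\<^sup>+\<^sup>1\<close>, because the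
  correction terms carry higher and higher powers of \<open>a\<close> on their right. Hence a single
  vanishing product \<open>E\<^sub>0E\<^sub>1\<dots>E\<^sub>k = 0\<close> makes \<open>a\<close> left strongly regular
  (\<open>left_strongly_regular_if_test_prod_zero\<close>). The two halves of the theorem are two reasons
  for such a product to vanish.

  If nil subrings are nilpotent, the reason is that \<open>a\<^sup>m(a - ax\<^sup>ma\<^sup>m) = 0\<close>. It gives
  \<open>E\<^sub>iE\<^sub>j = 0\<close> whenever \<open>j \<le> i\<close>, so the \<open>E\<^sub>i\<close> behave like strictly
  triangular matrices: a nonzero word in them has increasing indices, and the subring that they
  generate is nil (\<open>nil_subring_gen\<close>). The hypothesis is invariant under passing to the
  opposite ring, which gives the left-handed statement.

  In a left Goldie ring the reason is that every \<open>a - ax\<^sup>ma\<^sup>m\<close> is left singular, that is,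
  has an essential left annihilator (\<open>essential_left_annihilator_defect\<close>): right
  multiplication by \<open>a\<close> is injective on \<open>Ra\<close>, and a nonzero principal left ideal inside
  \<open>Ra\<close> that misses \<open>Ra\<^sup>m\<^sup>+\<^sup>1\<close> would, together with its images under
  multiplication by powers of \<open>a\<^sup>m\<close>, form an infinite direct sum. By the chain condition,
  products of left singular elements eventually vanish
  (\<open>essential_annihilators_prod_zero\<close>). The left-handed statement is the chain condition
  applied to the left annihilators of the powers of \<open>a\<close>
  (\<open>left_dischinger_if_acc_left_annihilators\<close>).
\<close>

section \<open>Positive powers\<close>

text \<open>
  Without an identity there is no power with exponent \<open>0\<close>; \<open>ppow a n\<close> is
  \<open>a\<^sup>n\<^sup>+\<^sup>1\<close>, and all exponents below are shifted accordingly.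
\<close>
abbreviation ppow :: "'a::ring \<Rightarrow> nat \<Rightarrow> 'a" where
  "ppow a n \<equiv> nprod (\<lambda>_. a) n"

lemma ppow_add: "ppow a m * ppow a n = ppow (a::'a::ring) (Suc (m + n))"
  by (induction n) (simp_all add: mult.assoc[symmetric])

lemma ppow_Suc_left: "ppow a (Suc n) = (a::'a::ring) * ppow a n"
  using ppow_add[of a 0 n] by simp

text \<open>
  Each factor \<open>x\<close> removes one factor \<open>a\<close>, as long as two of them are there to apply
  \<open>a\<^sup>2x = a\<close>; this is why at least one \<open>a\<close> must survive.
\<close>
lemma ppow_cancel:
  fixes a x :: "'a::ring"
  assumes "a = a * a * x"
  shows "ppow a (Suc (m + k)) * ppow x k = ppow a m"
proof (induction k arbitrary: m)
  case 0
  have "ppow a m * a * x = ppow a m"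
    using assms by (cases m) (simp_all add: mult.assoc)
  then show ?case by simp
next
  case (Suc k)
  have "ppow a (Suc (m + Suc k)) * ppow x (Suc k) = ppow a (Suc (Suc m + k)) * ppow x k * x"
    by (simp add: mult.assoc)
  also have "\<dots> = ppow a (Suc m) * x" by (simp only: Suc.IH)
  also have "\<dots> = ppow a m" using assms by (cases m) (simp_all add: mult.assoc)
  finally show ?case .
qed

lemma ppow_cancel_left:
  fixes a y :: "'a::ring"
  assumes "a = y * (a * a)"
  shows "ppow y k * ppow a (Suc (m + k)) = ppow a m"
proof (induction k arbitrary: m)
  case 0
  have "y * (a * ppow a m) = ppow a m"
  proof (cases m)
    case 0 with assms show ?thesis by simp
  next
    case (Suc l)
    then show ?thesis using assms
      by (metis ppow_Suc_left mult.assoc)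
  qed
  then show ?case by (simp add: ppow_Suc_left del: nprod.simps(2))
next
  case (Suc k)
  have "ppow y (Suc k) * ppow a (Suc (m + Suc k)) = y * (ppow y k * ppow a (Suc (Suc m + k)))"
    unfolding ppow_Suc_left[of y k] by (simp add: mult.assoc)
  also have "\<dots> = y * ppow a (Suc m)" by (simp only: Suc.IH)
  also have "\<dots> = ppow a m" using Suc.IH[of m] assms
    by (cases m) (simp_all add: ppow_Suc_left mult.assoc[symmetric] del: nprod.simps(2))
  finally show ?case .
qed

section \<open>A test sequence for strong regularity\<close>

definition defect :: "'a::ring \<Rightarrow> 'a \<Rightarrow> nat \<Rightarrow> 'a" where
  "defect a x n = a - a * ppow x n * ppow a n"

text \<open>
  With \<open>m = expo k\<close>, a product with leading power \<open>ppow a (2 * m)\<close> acquires, after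
  multiplication by the next test element, the leading power \<open>ppow a (2 * (2 * m + 2))\<close>,
  and the correction term of that element ends exactly one power of \<open>a\<close> later. The
  recursion is the slowest growth for which this works, and the initial value \<open>1\<close> is the
  least for which it works for the first factor.
\<close>
primrec expo :: "nat \<Rightarrow> nat" where
  "expo 0 = 1"
| "expo (Suc k) = 2 * expo k + 2"

definition test_seq :: "'a::ring \<Rightarrow> 'a \<Rightarrow> nat \<Rightarrow> 'a" where
  "test_seq a x k = defect a x (expo k) * ppow a (expo k)"

lemma mono_expo: "i \<le> j \<Longrightarrow> expo i \<le> expo j"
  by (rule lift_Suc_mono_le[of expo]) auto

lemma expo_pos: "0 < expo k"
  by (induction k) auto

text \<open>
  Only the right-hand ends of the two terms matter later: the correction term has at least
  one more factor \<open>a\<close> on its right than the leading term.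
\<close>
lemma test_seq_expand:
  "test_seq a x k = ppow a (Suc (expo k)) - a * ppow x (expo k) * ppow a (Suc (2 * expo k))"
  unfolding test_seq_def defect_def
  by (simp add: left_diff_distrib mult.assoc ppow_add mult_2 ppow_Suc_left del: nprod.simps(2))

text \<open>
  Expanding the product from the left, the leading term of the last factor shifts both terms of
  the induction hypothesis by the same power of \<open>a\<close>. The correction term of the last factor
  ends in so high a power that the whole preceding product may be absorbed into \<open>r\<close>.
\<close>
lemma prod_test_seq:
  "\<exists>r. nprod (test_seq a x) k = ppow a (2 * expo k) + r * ppow a (Suc (2 * expo k))"
proof (induction k)
  case 0
  have "test_seq a x 0 = ppow a (Suc 1) - a * ppow x 1 * ppow a (Suc 2)"
    by (simp only: test_seq_expand expo.simps mult_1_right)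
  then have "nprod (test_seq a x) 0 =
      ppow a (2 * expo 0) + (- (a * ppow x 1)) * ppow a (Suc (2 * expo 0))"
    by (simp add: numeral_2_eq_2)
  then show ?case by blast
next
  case (Suc k)
  then obtain r where
    r: "nprod (test_seq a x) k = ppow a (2 * expo k) + r * ppow a (Suc (2 * expo k))" by blast
  let ?n = "expo (Suc k)" and ?Q = "nprod (test_seq a x) k"
  have "?Q * ppow a (Suc ?n) = ppow a (2 * ?n) + r * ppow a (Suc (2 * ?n))"
    unfolding r distrib_right mult.assoc ppow_add by (simp add: algebra_simps)
  then have "nprod (test_seq a x) (Suc k) =
      ppow a (2 * ?n) + (r - ?Q * (a * ppow x ?n)) * ppow a (Suc (2 * ?n))"
    unfolding nprod.simps(2)[of "test_seq a x"] test_seq_expand right_diff_distrib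
      left_diff_distrib by (simp add: mult.assoc del: nprod.simps)
  then show ?case by blast
qed

text \<open>
  A vanishing product reads \<open>a\<^sup>s = -ra\<^sup>s\<^sup>+\<^sup>1\<close> with \<open>s \<ge> 2\<close>; multiplying by
  \<open>x\<^sup>s\<^sup>-\<^sup>1\<close> on the right turns it into \<open>a = -ra\<^sup>2\<close>.
\<close>
lemma left_strongly_regular_if_test_prod_zero:
  fixes a x :: "'a::ring"
  assumes a: "a = a * a * x" and zero: "nprod (test_seq a x) k = 0"
  shows "left_strongly_regular a"
proof -
  obtain r where r: "ppow a (2 * expo k) + r * ppow a (Suc (2 * expo k)) = 0"
    using prod_test_seq[of a x k] zero by metis
  obtain j where j: "2 * expo k = Suc j"
    using expo_pos[of k] by (metis gr0_conv_Suc nat_0_less_mult_iff zero_less_numeral)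
  have "0 = (ppow a (Suc j) + r * ppow a (Suc (Suc j))) * ppow x j"
    using r by (simp add: j)
  also have "\<dots> = a + r * (a * a)"
    using ppow_cancel[OF a, of 0 j] ppow_cancel[OF a, of 1 j]
    by (simp add: distrib_right mult.assoc)
  finally have "a = (- r) * (a * a)" by (simp add: eq_neg_iff_add_eq_0)
  then show ?thesis unfolding left_strongly_regular_def by blast
qed

text \<open>
  A sufficiently high power of \<open>a\<close> on the left undoes \<open>x\<^sup>n\<^sup>+\<^sup>1\<close>, and the
  \<open>a\<^sup>n\<^sup>+\<^sup>1\<close> on the right restores the power that was lost.
\<close>
lemma ppow_mult_defect:
  fixes a x :: "'a::ring"
  assumes a: "a = a * a * x" and "n \<le> m"
  shows "ppow a m * defect a x n = 0"
proof -
  have "ppow a m * a * ppow x n * ppow a n = ppow a m * a"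
  proof -
    have "ppow a m * a * ppow x n = ppow a (m - n)"
      using ppow_cancel[OF a, of "m - n" n] \<open>n \<le> m\<close> by simp
    moreover have "ppow a (m - n) * ppow a n = ppow a m * a"
      using \<open>n \<le> m\<close> by (simp only: ppow_add) simp
    ultimately show ?thesis by simp
  qed
  then show ?thesis unfolding defect_def by (simp add: right_diff_distrib mult.assoc)
qed

lemma test_seq_mult_zero:
  fixes a x :: "'a::ring"
  assumes "a = a * a * x" and "j \<le> i"
  shows "test_seq a x i * test_seq a x j = 0"
proof -
  have "test_seq a x i * test_seq a x j = 
    defect a x (expo i) * (ppow a (expo i) * defect a x (expo j)) * ppow a (expo j)"
    by (simp add: test_seq_def mult.assoc)
  then show ?thesis using ppow_mult_defect[OF assms(1) mono_expo[OF assms(2)]] by simp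
qed

section \<open>Nil subrings\<close>

inductive_set subring_gen :: "'a::ring set \<Rightarrow> 'a set" for S where
  base: "s \<in> S \<Longrightarrow> s \<in> subring_gen S"
| zero: "0 \<in> subring_gen S"
| diff: "s \<in> subring_gen S \<Longrightarrow> t \<in> subring_gen S \<Longrightarrow> s - t \<in> subring_gen S"
| mult: "s \<in> subring_gen S \<Longrightarrow> t \<in> subring_gen S \<Longrightarrow> s * t \<in> subring_gen S"

lemma is_subring_subring_gen: "is_subring (subring_gen S)"
  unfolding is_subring_def by (auto intro: subring_gen.intros)

lemma subring_gen_mono: "t \<in> subring_gen S \<Longrightarrow> S \<subseteq> S' \<Longrightarrow> t \<in> subring_gen S'"
  by (induction rule: subring_gen.induct) (auto intro: subring_gen.intros)

lemma subring_gen_annihilated: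
  assumes "t \<in> subring_gen S" and "\<And>s. s \<in> S \<Longrightarrow> u * s = 0"
  shows "u * t = 0"
  using assms(1)
  by (induction rule: subring_gen.induct)
    (simp_all add: assms(2) right_diff_distrib mult.assoc[symmetric])

text \<open>
  Words ending in the last generator \<open>E N\<close> annihilate the whole subring from the left,
  because \<open>E N\<close> annihilates every generator up to itself. So the subring splits, modulo
  such words, as the subring of the earlier generators. This drives the induction in
  \<open>subring_gen_ppow_zero\<close>.
\<close>
lemma subring_gen_last_generator:
  fixes E :: "nat \<Rightarrow> 'a::ring"
  assumes E: "\<And>i j. j \<le> i \<Longrightarrow> E i * E j = 0"
    and "t \<in> subring_gen (E ` {..<Suc N})"
  shows "\<exists>t' u. t = t' + u \<and> t' \<in> subring_gen (E ` {..<N}) \<and>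
      (\<forall>s\<in>subring_gen (E ` {..<Suc N}). u * s = 0)"
  using assms(2)
proof (induction rule: subring_gen.induct)
  case (base s)
  then obtain i where i: "s = E i" "i < Suc N" by auto
  show ?case
  proof (cases "i < N")
    case True
    then show ?thesis using i
      by (intro exI[of _ s] exI[of _ 0]) (auto intro: subring_gen.base)
  next
    case False
    then have "i = N" using i by simp
    moreover have "E N * s = 0" if "s \<in> subring_gen (E ` {..<Suc N})" for s
      using that by (rule subring_gen_annihilated) (auto intro: E)
    ultimately show ?thesis using i
      by (intro exI[of _ 0] exI[of _ s]) (auto intro: subring_gen.zero)
  qed
next
  case zero
  show ?case by (intro exI[of _ 0]) (auto intro: subring_gen.zero)
next
  case (diff s t)
  then obtain s' u t' v where *: "s = s' + u" "t = t' + v"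
    "s' \<in> subring_gen (E ` {..<N})" "t' \<in> subring_gen (E ` {..<N})"
    "\<forall>r\<in>subring_gen (E ` {..<Suc N}). u * r = 0"
    "\<forall>r\<in>subring_gen (E ` {..<Suc N}). v * r = 0" by metis
  show ?case
    by (intro exI[of _ "s' - t'"] exI[of _ "u - v"])
      (use * in \<open>auto simp: left_diff_distrib intro: subring_gen.diff\<close>)
next
  case (mult s t)
  then obtain s' u t' v where *: "s = s' + u" "t = t' + v"
    "s' \<in> subring_gen (E ` {..<N})" "t' \<in> subring_gen (E ` {..<N})"
    "\<forall>r\<in>subring_gen (E ` {..<Suc N}). u * r = 0"
    "\<forall>r\<in>subring_gen (E ` {..<Suc N}). v * r = 0" by metis
  have "s * t = s' * t + u * t" by (simp add: * distrib_right)
  also have "u * t = 0" using *(5) mult.hyps(2) by blast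
  also have "s' * t + 0 = s' * t' + s' * v" by (simp add: *(2) distrib_left)
  finally show ?case
    by (intro exI[of _ "s' * t'"] exI[of _ "s' * v"])
      (use * in \<open>auto simp: mult.assoc intro: subring_gen.mult\<close>)
qed

text \<open>
  If \<open>t = t' + u\<close> with \<open>ut = 0\<close>, then \<open>t\<^sup>n\<^sup>+\<^sup>1 = t'\<^sup>nt\<close>, so each generator
  raises the nilpotency index by at most one.
\<close>
lemma subring_gen_ppow_zero:
  fixes E :: "nat \<Rightarrow> 'a::ring"
  assumes E: "\<And>i j. j \<le> i \<Longrightarrow> E i * E j = 0"
  shows "t \<in> subring_gen (E ` {..<N}) \<Longrightarrow> ppow t N = 0"
proof (induction N arbitrary: t)
  case 0
  then have "t \<in> subring_gen {}" by simp
  then have "t = 0" by (induction rule: subring_gen.induct) auto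
  then show ?case by simp
next
  case (Suc N)
  obtain t' u where t: "t = t' + u" "t' \<in> subring_gen (E ` {..<N})"
    and u: "\<forall>s\<in>subring_gen (E ` {..<Suc N}). u * s = 0"
    using subring_gen_last_generator[OF E Suc.prems] by blast
  have "u * t = 0" using u Suc.prems by blast
  then have tt: "t * t = t' * t" by (simp add: t(1) distrib_right)
  have "ppow t (Suc n) = ppow t' n * t" for n
  proof (induction n)
    case 0 show ?case using tt by simp
  next
    case (Suc n)
    have "ppow t (Suc (Suc n)) = ppow t' n * (t * t)"
      unfolding nprod.simps(2)[of _ "Suc n"] Suc.IH by (simp add: mult.assoc)
    then show ?case unfolding tt by (simp add: mult.assoc)
  qed
  then show ?case using Suc.IH[OF t(2)] by simp
qed

text \<open>
  Nilness, unlike nilpotency, is a property of single elements, and each element involves only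
  finitely many generators.
\<close>
lemma nil_subring_gen:
  fixes E :: "nat \<Rightarrow> 'a::ring"
  assumes E: "\<And>i j. j \<le> i \<Longrightarrow> E i * E j = 0"
  shows "nil_set (subring_gen (range E))"
proof -
  have mono: "t \<in> subring_gen (E ` {..<N})" 
    if "t \<in> subring_gen (E ` {..<M})" "M \<le> N" for t M N
    using that(1) by (rule subring_gen_mono) (use that(2) in auto)
  have "\<exists>N. t \<in> subring_gen (E ` {..<N})" if "t \<in> subring_gen (range E)" for t
    using that
  proof (induction rule: subring_gen.induct)
    case (base s)
    then obtain i where "s = E i" by blast
    then have "s \<in> E ` {..<Suc i}" by blast
    then show ?case by (intro exI subring_gen.base)
  next
    case zero
    show ?case by (blast intro: subring_gen.zero)
  next
    case (diff s t)
    then obtain M N where "s \<in> subring_gen (E ` {..<M})" "t \<in> subring_gen (E ` {..<N})" by blast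
    then have "s \<in> subring_gen (E ` {..<max M N})" "t \<in> subring_gen (E ` {..<max M N})"
      by (meson mono max.cobounded1 max.cobounded2)+
    then show ?case by (blast intro: subring_gen.diff)
  next
    case (mult s t)
    then obtain M N where "s \<in> subring_gen (E ` {..<M})" "t \<in> subring_gen (E ` {..<N})" by blast
    then have "s \<in> subring_gen (E ` {..<max M N})" "t \<in> subring_gen (E ` {..<max M N})"
      by (meson mono max.cobounded1 max.cobounded2)+
    then show ?case by (blast intro: subring_gen.mult)
  qed
  then show ?thesis
    unfolding nil_set_def nilpotent_element_def using subring_gen_ppow_zero[of E, OF E] by blast
qed

lemma right_dischinger_if_nil_subrings_nilpotent:
  assumes "\<And>T :: 'a::ring set. is_subring T \<Longrightarrow> nil_set T \<Longrightarrow> nilpotent_set T"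
  shows "right_dischinger TYPE('a)"
  unfolding right_dischinger_def
proof (intro allI impI)
  fix a :: 'a
  assume rsr: "right_strongly_regular a"
  then obtain x where a: "a = a * a * x" unfolding right_strongly_regular_def by blast
  have "nilpotent_set (subring_gen (range (test_seq a x)))"
    by (intro assms is_subring_subring_gen nil_subring_gen test_seq_mult_zero a)
  then obtain k where "nprod (test_seq a x) k = 0"
    unfolding nilpotent_set_def by (blast intro: subring_gen.base)
  then show "strongly_regular a"
    using rsr left_strongly_regular_if_test_prod_zero[OF a] unfolding strongly_regular_def by blast
qed

section \<open>The opposite ring\<close>

text \<open>
  A ring is represented by a type, so the opposite ring has to be a new type.
\<close>
datatype 'a opp = Opp (unopp: 'a)

instantiation opp :: (ring) ring
begin
definition "0 = Opp 0"
definition "x + y = Opp (unopp x + unopp y)"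
definition "x - y = Opp (unopp x - unopp y)"
definition "- x = Opp (- unopp x)"
definition "x * y = Opp (unopp y * unopp x)"
instance
  by standard
    (auto simp: zero_opp_def plus_opp_def minus_opp_def uminus_opp_def times_opp_def
      algebra_simps opp.expand)
end

lemma nprod_Suc_left: "nprod f (Suc n) = f 0 * nprod (\<lambda>i. f (Suc i)) n"
  by (induction n) (simp_all add: mult.assoc)

lemma unopp_nprod: "unopp (nprod f n) = nprod (\<lambda>i. unopp (f (n - i))) n"
proof (induction n)
  case (Suc n)
  have "unopp (nprod f (Suc n)) = unopp (f (Suc n)) * nprod (\<lambda>i. unopp (f (n - i))) n"
    using Suc by (simp add: times_opp_def)
  then show ?case by (simp add: nprod_Suc_left del: nprod.simps(2))
qed simp

lemma nil_subrings_nilpotent_opp: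
  fixes T :: "'a::ring opp set"
  assumes H: "\<And>T :: 'a set. is_subring T \<Longrightarrow> nil_set T \<Longrightarrow> nilpotent_set T"
    and T: "is_subring T" "nil_set T"
  shows "nilpotent_set T"
proof -
  have "is_subring (unopp ` T)"
    unfolding is_subring_def
  proof (intro conjI ballI)
    show "0 \<in> unopp ` T"
      using T(1) unfolding is_subring_def zero_opp_def by force
  next
    fix x y assume "x \<in> unopp ` T" "y \<in> unopp ` T"
    then obtain s t where st: "s \<in> T" "t \<in> T" "x = unopp s" "y = unopp t" by blast
    then have "s - t \<in> T" "t * s \<in> T" using T(1) unfolding is_subring_def by blast+
    then show "x - y \<in> unopp ` T" "x * y \<in> unopp ` T"
      using st by (force simp: minus_opp_def times_opp_def)+
  qed
  moreover have "nil_set (unopp ` T)"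
    unfolding nil_set_def
  proof
    fix x assume "x \<in> unopp ` T"
    then obtain t where t: "t \<in> T" "x = unopp t" by blast
    then obtain n where "nprod (\<lambda>_. t) n = 0"
      using T(2) unfolding nil_set_def nilpotent_element_def by blast
    then have "nprod (\<lambda>_. x) n = 0"
      using unopp_nprod[of "\<lambda>_. t" n] by (simp add: t(2) zero_opp_def)
    then show "nilpotent_element x" unfolding nilpotent_element_def by blast
  qed
  ultimately obtain n where n: "\<forall>f. (\<forall>i\<le>n. f i \<in> unopp ` T) \<longrightarrow> nprod f n = 0"
    using H unfolding nilpotent_set_def by blast
  have "nprod f n = 0" if "\<forall>i\<le>n. f i \<in> T" for f
  proof -
    have "unopp (nprod f n) = 0" unfolding unopp_nprod using n that by simp
    then show ?thesis by (metis opp.collapse zero_opp_def)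
  qed
  then show ?thesis unfolding nilpotent_set_def by blast
qed

lemma left_dischinger_if_right_dischinger_opp:
  assumes "right_dischinger TYPE('a::ring opp)"
  shows "left_dischinger TYPE('a)"
  unfolding left_dischinger_def
proof (intro allI impI)
  fix a :: 'a
  assume lsr: "left_strongly_regular a"
  then obtain y where y: "a = y * (a * a)" unfolding left_strongly_regular_def by blast
  then have "right_strongly_regular (Opp a)"
    unfolding right_strongly_regular_def by (intro exI[of _ "Opp y"]) (simp add: times_opp_def)
  then have "left_strongly_regular (Opp a)"
    using assms unfolding right_dischinger_def strongly_regular_def by blast
  then obtain z where "Opp a = z * (Opp a * Opp a)" unfolding left_strongly_regular_def by blast
  then have "a = a * a * unopp z" by (simp add: times_opp_def)
  then show "strongly_regular a"
    using lsr unfolding strongly_regular_def right_strongly_regular_def by blast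
qed

lemma dischinger_if_nil_subrings_nilpotent:
  assumes "\<And>T :: 'a::ring set. is_subring T \<Longrightarrow> nil_set T \<Longrightarrow> nilpotent_set T"
  shows "dischinger TYPE('a)"
  unfolding dischinger_def
  by (intro conjI left_dischinger_if_right_dischinger_opp
      right_dischinger_if_nil_subrings_nilpotent nil_subrings_nilpotent_opp assms)

section \<open>Left annihilators\<close>

lemma left_ideal_left_annihilator: "left_ideal (left_annihilator S)"
  unfolding left_ideal_def left_annihilator_def
  by (auto simp: left_diff_distrib mult.assoc)

lemma left_ideal_principal: "left_ideal (range (\<lambda>r. r * (c::'a::ring)))"
  unfolding left_ideal_def
  by (auto simp: left_diff_distrib[symmetric] mult.assoc[symmetric] intro: range_eqI[of _ _ 0])

lemma essential_left_ideal_meets_principal: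
  fixes c :: "'a::ring"
  assumes id: "has_identity TYPE('a)" and L: "essential_left_ideal L" and c: "c \<noteq> 0"
  shows "\<exists>r. r * c \<in> L \<and> r * c \<noteq> 0"
proof -
  obtain e :: 'a where e: "\<And>x. e * x = x" using id unfolding has_identity_def by blast
  have "range (\<lambda>r. r * c) \<noteq> {0}" using e c by (metis rangeI singletonD)
  then have "L \<inter> range (\<lambda>r. r * c) \<noteq> {0}"
    using L left_ideal_principal unfolding essential_left_ideal_def by blast
  moreover have "0 \<in> L \<inter> range (\<lambda>r. r * c)"
    using L unfolding essential_left_ideal_def left_ideal_def
    by (auto intro: range_eqI[of _ _ 0])
  ultimately show ?thesis by blast
qed

text \<open>
  Let \<open>a = ya\<^sup>2\<close>. The element \<open>v = a - a\<^sup>my\<^sup>ma\<close> satisfies \<open>va\<^sup>m = 0\<close>. Once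
  the annihilators of the powers of \<open>a\<close> are stationary from \<open>a\<^sup>n\<close> on, also
  \<open>va\<^sup>n = 0\<close>; with \<open>m = n + 2\<close> this puts \<open>a\<^sup>n\<^sup>+\<^sup>1\<close> into
  \<open>a\<^sup>n\<^sup>+\<^sup>2R\<close>, and powers of \<open>y\<close> on the left cancel the excess.
\<close>
lemma left_dischinger_if_acc_left_annihilators:
  assumes "acc_left_annihilators TYPE('a::ring)"
  shows "left_dischinger TYPE('a)"
  unfolding left_dischinger_def
proof (intro allI impI)
  fix a :: 'a
  assume lsr: "left_strongly_regular a"
  then obtain y where y: "a = y * (a * a)" unfolding left_strongly_regular_def by blast
  let ?A = "\<lambda>n. left_annihilator {ppow a n}"
  have "?A i \<subseteq> ?A (Suc i)" for i
    by (auto simp: left_annihilator_def mult.assoc[symmetric])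
  then obtain n where n: "\<And>m. m \<ge> n \<Longrightarrow> ?A m = ?A n"
    using assms[unfolded acc_left_annihilators_def, rule_format, of ?A] by blast
  define v where "v = a - ppow a (n + 2) * ppow y (n + 2) * a"
  have "ppow y (n + 2) * (a * ppow a (n + 2)) = a"
    using ppow_cancel_left[OF y, of "n + 2" 0] by (simp add: ppow_Suc_left del: nprod.simps(2))
  then have "v * ppow a (n + 2) = 0"
    unfolding v_def left_diff_distrib mult.assoc 
    by (metis Suc_eq_plus1 add_2_eq_Suc' mult.assoc nprod.simps ppow_Suc_left right_minus_eq)
  then have "v \<in> ?A n" using n[of "n + 2"] by (auto simp: left_annihilator_def)
  then have "a * ppow a n = ppow a (n + 2) * ppow y (n + 2) * a * ppow a n"
    by (simp add: left_annihilator_def v_def left_diff_distrib)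
  then have *: "ppow a (Suc n) = ppow a (Suc (Suc n)) * (ppow y (n + 2) * a * ppow a n)"
    unfolding ppow_Suc_left[of a n] by (simp add: mult.assoc)
  have "a = ppow y n * ppow a (Suc n)"
    using ppow_cancel_left[OF y, of n 0] by simp
  also have "\<dots> = ppow y n * ppow a (Suc (Suc n)) * (ppow y (n + 2) * a * ppow a n)"
    by (subst *) (simp only: mult.assoc)
  also have "ppow y n * ppow a (Suc (Suc n)) = a * a"
    using ppow_cancel_left[OF y, of n 1] by simp
  finally show "strongly_regular a"
    using lsr unfolding strongly_regular_def right_strongly_regular_def by blast
qed

text \<open>
  The left annihilators of the partial products increase, so they are stationary from some
  \<open>p = z 0 * \<dots> * z n\<close> on. If \<open>p \<noteq> 0\<close>, then the essential annihilator of
  \<open>z (n + 1)\<close> meets \<open>Rp\<close>: some \<open>rp \<noteq> 0\<close> is annihilated by \<open>z (n + 1)\<close>, and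
  \<open>r\<close> is a new element of the next annihilator, a contradiction.
\<close>
lemma essential_annihilators_prod_zero:
  fixes z :: "nat \<Rightarrow> 'a::ring"
  assumes id: "has_identity TYPE('a)" and acc: "acc_left_annihilators TYPE('a)"
    and ess: "\<And>i. essential_left_ideal (left_annihilator {z i})"
  shows "\<exists>k. nprod z k = 0"
proof (rule ccontr)
  assume nz: "\<nexists>k. nprod z k = 0"
  let ?A = "\<lambda>n. left_annihilator {nprod z n}"
  have "?A i \<subseteq> ?A (Suc i)" for i
    by (auto simp: left_annihilator_def mult.assoc[symmetric])
  then obtain n where n: "\<And>m. m \<ge> n \<Longrightarrow> ?A m = ?A n"
    using acc[unfolded acc_left_annihilators_def, rule_format, of ?A] by blast
  obtain r where r: "r * nprod z n \<in> left_annihilator {z (Suc n)}" "r * nprod z n \<noteq> 0"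
    using essential_left_ideal_meets_principal[OF id ess] nz by metis
  from r(1) have "r \<in> ?A (Suc n)" by (simp add: left_annihilator_def mult.assoc)
  then have "r \<in> ?A n" using n[of "Suc n"] by simp
  then show False using r(2) by (simp add: left_annihilator_def)
qed

section \<open>Finite uniform dimension\<close>

text \<open>
  The principal left ideals of the \<open>c i\<close> are nonzero and form an infinite direct sum.
  Working with such sequences of elements rather than with finite families of left ideals
  avoids counting: the exchange argument may discard finitely many members.
\<close>
definition independent_elements :: "(nat \<Rightarrow> 'a::ring) \<Rightarrow> bool" where
  "independent_elements c \<longleftrightarrow> (\<forall>i. c i \<noteq> 0) \<and>
     (\<forall>n r. (\<Sum>i<n. r i * c i) = 0 \<longrightarrow> (\<forall>i<n. r i * c i = 0))"

lemma independent_elements_scale: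
  assumes "independent_elements c" and "\<And>i. s i * c i \<noteq> 0"
  shows "independent_elements (\<lambda>i. s i * c i)"
  unfolding independent_elements_def
proof (intro conjI allI impI)
  fix n r i assume "(\<Sum>i<n. r i * (s i * c i)) = 0" "i < n"
  then show "r i * (s i * c i) = 0"
    using assms(1)[unfolded independent_elements_def, THEN conjunct2, rule_format,
        where n = n and r = "\<lambda>i. r i * s i" and i = i]
    by (simp add: mult.assoc)
qed (rule assms(2))

text \<open>
  A step of Gaussian elimination with the pivot \<open>c p\<close>: the terms before the pivot are
  discarded, and a multiple of the pivot is subtracted from a multiple of every later term. A
  relation between the new terms forces the parts in the later terms to vanish; what remains
  is a multiple of the pivot that lies in \<open>W\<close>, hence is \<open>0\<close>.
\<close>
lemma independent_elements_shift_pivot: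
  assumes c: "independent_elements c"
    and pivot: "\<And>r. r * c p \<in> W \<Longrightarrow> r * c p = 0"
    and W: "left_ideal W"
    and d: "\<And>i. d i = s i * c (p + Suc i) - t i * c p" "\<And>i. d i \<in> W" 
    and nz: "\<And>i. s i * c (p + Suc i) \<noteq> 0"
  shows "independent_elements d"
proof -
  have key: "\<forall>i<n. r i * d i = 0" if sum: "(\<Sum>i<n. r i * d i) = 0" for n r
  proof (intro allI impI)
    fix i assume i: "i < n"
    \<comment> \<open>the coefficients of the given relation, rewritten in terms of the \<open>c j\<close>\<close>
    define q where "q j = (if j < p then 0 else if j = p then - (\<Sum>i<n. r i * t i)
      else r (j - Suc p) * s (j - Suc p))" for j
    have "(\<Sum>j<p + Suc n. q j * c j) = (\<Sum>j<p. q j * c j) + (\<Sum>j<Suc n. q (p + j) * c (p + j))"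
      by (induction n) (simp_all add: add.assoc)
    also have "\<dots> = q p * c p + (\<Sum>j<n. q (p + Suc j) * c (p + Suc j))"
      by (simp add: q_def sum.lessThan_Suc_shift del: sum.lessThan_Suc)
    also have "\<dots> = (\<Sum>i<n. r i * d i)"
      by (simp add: q_def d(1) right_diff_distrib sum_subtractf sum_distrib_right mult.assoc)
    finally have "(\<Sum>j<p + Suc n. q j * c j) = 0" using sum by simp
    then have "q (p + Suc i) * c (p + Suc i) = 0"
      using c i unfolding independent_elements_def by (metis add_strict_left_mono Suc_mono)
    then have "r i * d i = (- (r i * t i)) * c p"
      by (simp add: q_def d(1) right_diff_distrib mult.assoc)
    moreover have "r i * d i \<in> W" using W d(2) unfolding left_ideal_def by blast
    ultimately show "r i * d i = 0" using pivot by metis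
  qed
  moreover have "d i \<noteq> 0" for i
  proof
    assume "d i = 0"
    define q where "q j = (if j = p then - t i else if j = p + Suc i then s i else 0)" for j
    have "(\<Sum>j<p + Suc (Suc i). q j * c j) = (\<Sum>j\<in>{p, p + Suc i}. q j * c j)"
      by (rule sum.mono_neutral_right) (auto simp: q_def)
    also have "\<dots> = d i" by (simp add: q_def d(1))
    finally have "q (p + Suc i) * c (p + Suc i) = 0"
      using c \<open>d i = 0\<close> unfolding independent_elements_def by (metis add_strict_left_mono lessI)
    then show False using nz[of i] by (simp add: q_def)
  qed
  ultimately show ?thesis unfolding independent_elements_def by blast
qed

lemma uniform_common_multiple:
  fixes u v :: "'a::ring"
  assumes id: "has_identity TYPE('a)" and U: "uniform_left_ideal U"
    and "u \<in> U" "v \<in> U" "u \<noteq> 0" "v \<noteq> 0"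
  shows "\<exists>s t. s * u = t * v \<and> s * u \<noteq> 0"
proof -
  obtain e :: 'a where e: "\<And>x. e * x = x" using id unfolding has_identity_def by blast
  let ?I = "range (\<lambda>r. r * u)" and ?J = "range (\<lambda>r. r * v)"
  have "?I \<subseteq> U" "?J \<subseteq> U"
    using U assms(3,4) unfolding uniform_left_ideal_def left_ideal_def by auto
  moreover have "?I \<noteq> {0}" "?J \<noteq> {0}" using e assms(5,6) by (metis rangeI singletonD)+
  ultimately have "?I \<inter> ?J \<noteq> {0}"
    using U[unfolded uniform_left_ideal_def, THEN conjunct2, THEN conjunct2, rule_format, of ?I ?J]
      left_ideal_principal[of u] left_ideal_principal[of v] by simp
  moreover have "0 \<in> ?I \<inter> ?J" by (auto intro: range_eqI[of _ _ 0])
  ultimately obtain z where "z \<in> ?I" "z \<in> ?J" "z \<noteq> 0" by blast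
  moreover from this obtain s t where "z = s * u" "z = t * v" by blast
  ultimately show ?thesis by metis
qed

text \<open>
  The principal left ideals of the sequence either all meet \<open>W\<close>, and then multiples do, or
  some \<open>R(c p)\<close> misses \<open>W\<close>. In the second case \<open>c p\<close> serves as a pivot: its component in
  \<open>U\<close> is nonzero, so, \<open>U\<close> being uniform, it has a common multiple with the component
  in \<open>U\<close> of any later term, and the difference of the corresponding multiples of the terms
  themselves lies in \<open>W\<close>.
\<close>
lemma independent_elements_drop_uniform:
  fixes W U :: "'a::ring set"
  assumes id: "has_identity TYPE('a)" and W: "left_ideal W" and U: "uniform_left_ideal U"
    and disj: "W \<inter> U \<subseteq> {0}"
    and c: "independent_elements c" "\<And>i. \<exists>w\<in>W. \<exists>u\<in>U. c i = w + u"
  shows "\<exists>d. independent_elements d \<and> (\<forall>i. d i \<in> W)"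
proof (cases "\<forall>i. \<exists>r. r * c i \<in> W \<and> r * c i \<noteq> 0")
  case True
  then obtain s where s: "\<And>i. s i * c i \<in> W" "\<And>i. s i * c i \<noteq> 0" by metis
  then show ?thesis using independent_elements_scale[OF c(1) s(2)] by blast
next
  case False
  then obtain p where pivot: "\<And>r. r * c p \<in> W \<Longrightarrow> r * c p = 0" by blast
  obtain e :: 'a where e: "\<And>x. e * x = x" using id unfolding has_identity_def by blast
  have Wm: "r * w \<in> W" if "w \<in> W" for r w using W that unfolding left_ideal_def by blast
  have Wd: "w - w' \<in> W" if "w \<in> W" "w' \<in> W" for w w'
    using W that unfolding left_ideal_def by blast
  have Um: "r * w \<in> U" if "w \<in> U" for r w
    using U that unfolding uniform_left_ideal_def left_ideal_def by simp
  have W0: "0 \<in> W" using W unfolding left_ideal_def by blast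
  obtain w u where cp: "w \<in> W" "u \<in> U" "c p = w + u" using c(2) by blast
  have nz: "c i \<noteq> 0" for i using c(1) unfolding independent_elements_def by blast
  have "u \<noteq> 0" using pivot[of e] e nz[of p] cp by auto
  have "\<exists>s t. s * c (p + Suc i) - t * c p \<in> W \<and> s * c (p + Suc i) \<noteq> 0" for i
  proof -
    obtain w' u' where ci: "w' \<in> W" "u' \<in> U" "c (p + Suc i) = w' + u'" using c(2) by blast
    show ?thesis
    proof (cases "u' = 0")
      case True
      then show ?thesis using ci e nz by (intro exI[of _ e] exI[of _ 0]) auto
    next
      case False
      then obtain s t where st: "s * u' = t * u" "s * u' \<noteq> 0"
        using uniform_common_multiple[OF id U ci(2) cp(2) _ \<open>u \<noteq> 0\<close>] by blast
      have mem: "s * c (p + Suc i) - t * c p \<in> W"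
      proof -
        have "s * c (p + Suc i) - t * c p = s * w' - t * w"
          unfolding ci(3) cp(3) distrib_left st(1) by simp
        then show ?thesis using Wd Wm ci(1) cp(1) by simp
      qed
      have "s * c (p + Suc i) \<noteq> 0"
      proof
        assume z: "s * c (p + Suc i) = 0"
        then have "s * u' = - (s * w')"
          unfolding ci(3) distrib_left by (simp add: add_eq_0_iff)
        also have "\<dots> \<in> W" using Wd[OF W0 Wm[OF ci(1)]] by simp
        finally have "s * u' \<in> W \<inter> U" using Um ci(2) by blast
        then show False using disj st(2) by blast
      qed
      with mem show ?thesis by blast
    qed
  qed
  then obtain s t where st: "\<And>i. s i * c (p + Suc i) - t i * c p \<in> W"
    "\<And>i. s i * c (p + Suc i) \<noteq> 0" by metis
  have "independent_elements (\<lambda>i. s i * c (p + Suc i) - t i * c p)"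
    by (rule independent_elements_shift_pivot[where s = s and t = t, OF c(1) pivot W _ _ st(2)])
      (simp_all only: st(1))
  then show ?thesis using st(1) by blast
qed

lemma left_ideal_sum_left_ideals:
  assumes "\<And>i. i < n \<Longrightarrow> left_ideal (U i)"
  shows "left_ideal (sum_left_ideals n U)"
  unfolding left_ideal_def
proof (intro conjI ballI allI)
  show "0 \<in> sum_left_ideals n U"
    unfolding sum_left_ideals_def using assms
    by (auto simp: left_ideal_def intro!: exI[of _ "\<lambda>_. 0"])
next
  fix f g assume "f \<in> sum_left_ideals n U" "g \<in> sum_left_ideals n U"
  then obtain x y where "f = sum x {..<n}" "g = sum y {..<n}" "\<forall>i<n. x i \<in> U i" "\<forall>i<n. y i \<in> U i"
    unfolding sum_left_ideals_def by blast
  then show "f - g \<in> sum_left_ideals n U"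
    unfolding sum_left_ideals_def using assms
    by (auto simp: left_ideal_def sum_subtractf intro!: exI[of _ "\<lambda>i. x i - y i"])
next
  fix r f assume "f \<in> sum_left_ideals n U"
  then obtain x where "f = sum x {..<n}" "\<forall>i<n. x i \<in> U i"
    unfolding sum_left_ideals_def by blast
  then show "r * f \<in> sum_left_ideals n U"
    unfolding sum_left_ideals_def using assms
    by (auto simp: left_ideal_def sum_distrib_left intro!: exI[of _ "\<lambda>i. r * x i"])
qed

text \<open>
  Dropping one uniform summand at a time moves an independent sequence down to the zero ideal,
  which has no nonzero elements.
\<close>
lemma no_independent_elements_sum_uniform:
  fixes U :: "nat \<Rightarrow> 'a::ring set"
  assumes id: "has_identity TYPE('a)" and U: "\<And>i. i < n \<Longrightarrow> uniform_left_ideal (U i)"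
    and ind: "independent_left_ideals n U"
  shows "k \<le> n \<Longrightarrow> independent_elements c \<Longrightarrow> \<exists>i. c i \<notin> sum_left_ideals k U"
proof (induction k arbitrary: c)
  case 0
  then show ?case unfolding sum_left_ideals_def independent_elements_def by auto
next
  case (Suc k)
  show ?case
  proof (rule ccontr)
    assume "\<nexists>i. c i \<notin> sum_left_ideals (Suc k) U"
    then have c: "c i \<in> sum_left_ideals (Suc k) U" for i by blast
    let ?W = "sum_left_ideals k U"
    have LI: "left_ideal (U i)" if "i < n" for i
      using U[OF that] unfolding uniform_left_ideal_def by blast
    have W: "left_ideal ?W" using LI Suc.prems(1) by (intro left_ideal_sum_left_ideals) auto
    have split: "\<exists>w\<in>?W. \<exists>u\<in>U k. c i = w + u" for i
    proof -
      obtain x where "c i = sum x {..<Suc k}" "\<forall>j<Suc k. x j \<in> U j"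
        using c[of i] unfolding sum_left_ideals_def by blast
      then show ?thesis
        unfolding sum_left_ideals_def by (intro bexI[of _ "sum x {..<k}"] bexI[of _ "x k"]) auto
    qed
    have "?W \<inter> U k \<subseteq> {0}"
    proof
      fix v assume v: "v \<in> ?W \<inter> U k"
      then obtain x where x: "v = sum x {..<k}" "\<forall>j<k. x j \<in> U j"
        unfolding sum_left_ideals_def by blast
      \<comment> \<open>the relation \<open>x 0 + \<dots> + x (k - 1) - v = 0\<close>, extended by zeros to all \<open>n\<close> summands\<close>
      define y where "y j = (if j < k then x j else if j = k then - v else 0)" for j
      have "- v \<in> U k" using LI[of k] Suc.prems(1) v unfolding left_ideal_def by fastforce
      then have "\<forall>j<n. y j \<in> U j"
        using x LI unfolding y_def left_ideal_def by auto
      moreover have "sum y {..<n} = 0"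
      proof -
        have "sum y {..<n} = sum y {..<Suc k}"
          using Suc.prems(1) by (intro sum.mono_neutral_right) (auto simp: y_def)
        also have "\<dots> = 0" by (simp add: y_def x(1))
        finally show ?thesis .
      qed
      ultimately have "y k = 0"
        using ind Suc.prems(1) unfolding independent_left_ideals_def by simp
      then show "v \<in> {0}" by (simp add: y_def)
    qed
    then obtain d where "independent_elements d" "\<forall>i. d i \<in> ?W"
      using independent_elements_drop_uniform[OF id W U _ Suc.prems(2) split] Suc.prems(1)
      by (metis Suc_le_eq)
    then show False using Suc.IH[of d] Suc.prems(1) by auto
  qed
qed

lemma no_independent_elements:
  fixes c :: "nat \<Rightarrow> 'a::ring"
  assumes id: "has_identity TYPE('a)" and dim: "left_uniform_dim TYPE('a) n"
  shows "\<not> independent_elements c"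
proof
  assume c: "independent_elements c"
  obtain U :: "nat \<Rightarrow> 'a set" where U: "\<forall>i<n. uniform_left_ideal (U i)"
    "independent_left_ideals n U" "essential_left_ideal (sum_left_ideals n U)"
    using dim unfolding left_uniform_dim_def by blast
  have "\<exists>r. r * c i \<in> sum_left_ideals n U \<and> r * c i \<noteq> 0" for i
    using essential_left_ideal_meets_principal[OF id U(3)] c
    unfolding independent_elements_def by blast
  then obtain s where s: "\<And>i. s i * c i \<in> sum_left_ideals n U" "\<And>i. s i * c i \<noteq> 0" by metis
  then show False
    using no_independent_elements_sum_uniform[OF id _ U(2) _ independent_elements_scale[OF c s(2)],
        of n] U(1) by auto
qed

section \<open>Left Goldie rings\<close>

text \<open>
  Independence is witnessed by \<open>c i = ba\<^sup>(\<^sup>n\<^sup>+\<^sup>1\<^sup>)\<^sup>i\<^sup>+\<^sup>1\<close>. In a relation between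
  these elements, all terms but the first lie in \<open>Ra\<^sup>n\<^sup>+\<^sup>2\<close>, which meets \<open>Rba\<close>
  trivially. So the first term vanishes, and \<open>a\<^sup>n\<^sup>+\<^sup>1\<close> can be cancelled from the
  rest, since right multiplication by it is injective on \<open>Ra\<close>.
\<close>
lemma independent_elements_powers:
  fixes a b x :: "'a::ring"
  assumes a: "a = a * a * x" and ba: "b * a \<noteq> 0"
    and disj: "\<And>r t. r * (b * a) = t * ppow a (Suc n) \<Longrightarrow> r * (b * a) = 0"
  shows "\<exists>c::nat \<Rightarrow> 'a. independent_elements c"
proof -
  define f where "f = rec_nat b (\<lambda>_ y. y * ppow a n)"
  define c where "c i = f i * a" for i
  have comm: "ppow a n * a = a * ppow a n" by (metis nprod.simps(2) ppow_Suc_left)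
  have c0: "c 0 = b * a" by (simp add: c_def f_def)
  have cS: "c (Suc i) = c i * ppow a n" for i
    by (simp add: c_def f_def mult.assoc comm)
  have cancel: "y * a = 0" if "y * a * ppow a n = 0" for y
  proof -
    have "y * a = y * (a * ppow a n) * ppow x n"
      using ppow_cancel[OF a, of 0 n] by (simp add: mult.assoc ppow_Suc_left del: nprod.simps(2))
    also have "\<dots> = 0" using that by (simp add: mult.assoc[symmetric])
    finally show ?thesis .
  qed
  have "\<forall>i<m. r i * c i = 0" if "(\<Sum>i<m. r i * c i) = 0" for m r
    using that
  proof (induction m arbitrary: r)
    case (Suc m)
    define y where "y = (\<Sum>i<m. r (Suc i) * f i)"
    have tail: "y * a = (\<Sum>i<m. r (Suc i) * c i)"
      by (simp add: y_def c_def sum_distrib_right mult.assoc)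
    have "0 = r 0 * (b * a) + y * a * ppow a n"
      using Suc.prems unfolding tail
      by (simp add: sum.lessThan_Suc_shift c0 cS sum_distrib_right mult.assoc
          del: sum.lessThan_Suc)
    then have eq: "r 0 * (b * a) = - (y * a * ppow a n)" by (simp add: eq_neg_iff_add_eq_0)
    also have "\<dots> = (- y) * ppow a (Suc n)"
      by (simp add: ppow_Suc_left mult.assoc del: nprod.simps(2))
    finally have r0: "r 0 * (b * a) = 0" by (rule disj)
    then have "y * a = 0" using eq cancel by simp
    then have "\<forall>i<m. r (Suc i) * c i = 0" using Suc.IH[of "\<lambda>i. r (Suc i)"] tail by simp
    then show ?case using r0 c0 cS by (auto simp: less_Suc_eq_0_disj mult.assoc[symmetric])
  qed simp
  moreover have "c i \<noteq> 0" for i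
  proof (induction i)
    case 0 then show ?case using ba c0 by simp
  next
    case (Suc i) then show ?case using cS cancel[of "f i"] by (auto simp: c_def)
  qed
  ultimately show ?thesis unfolding independent_elements_def by blast
qed

text \<open>
  If \<open>sa = ta\<^sup>n\<^sup>+\<^sup>2\<close>, then \<open>sax\<^sup>n\<^sup>+\<^sup>1 = ta\<close>, and multiplying by
  \<open>a\<^sup>n\<^sup>+\<^sup>1\<close> gives back \<open>sa\<close>; so \<open>s\<close> annihilates the defect. Such nonzero \<open>s\<close>
  exist in every nonzero left ideal, because otherwise \<open>independent_elements_powers\<close>
  produces an infinite direct sum.
\<close>
lemma essential_left_annihilator_defect:
  fixes a x :: "'a::ring"
  assumes id: "has_identity TYPE('a)" and dim: "left_uniform_dim TYPE('a) d"
    and a: "a = a * a * x"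
  shows "essential_left_ideal (left_annihilator {defect a x n})"
  unfolding essential_left_ideal_def
proof (intro conjI allI impI)
  show "left_ideal (left_annihilator {defect a x n})" by (rule left_ideal_left_annihilator)
  fix I :: "'a set" assume I: "left_ideal I \<and> I \<noteq> {0}"
  then obtain b where b: "b \<in> I" "b \<noteq> 0" unfolding left_ideal_def by blast
  have "\<exists>s\<in>I. s \<noteq> 0 \<and> s \<in> left_annihilator {defect a x n}"
  proof (cases "b * a = 0")
    case True
    then have "b * defect a x n = 0"
      by (simp add: defect_def right_diff_distrib mult.assoc[symmetric])
    then show ?thesis using b unfolding left_annihilator_def by auto
  next
    case False
    then obtain r t where rt: "r * (b * a) = t * ppow a (Suc n)" "r * (b * a) \<noteq> 0"
      using independent_elements_powers[OF a False, of n] no_independent_elements[OF id dim] by blast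
    have "r * b * a * ppow x n = t * a"
      using rt(1) ppow_cancel[OF a, of 0 n] by (simp add: mult.assoc)
    then have "r * b * (a * ppow x n * ppow a n) = t * a * ppow a n"
      by (simp add: mult.assoc[symmetric])
    also have "\<dots> = r * b * a"
      using rt(1) by (simp add: mult.assoc ppow_Suc_left del: nprod.simps(2))
    finally have "r * b \<in> left_annihilator {defect a x n}"
      by (simp add: left_annihilator_def defect_def right_diff_distrib)
    moreover have "r * b \<in> I" using I b unfolding left_ideal_def by blast
    moreover have "r * b \<noteq> 0" using rt(2) by (auto simp: mult.assoc[symmetric])
    ultimately show ?thesis by blast
  qed
  then show "left_annihilator {defect a x n} \<inter> I \<noteq> {0}"
    by blast
qed

lemma essential_left_annihilator_mult:
  assumes "essential_left_ideal (left_annihilator {z})"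
  shows "essential_left_ideal (left_annihilator {z * b})"
proof -
  have sub: "left_annihilator {z} \<subseteq> left_annihilator {z * b}"
    by (auto simp: left_annihilator_def mult.assoc[symmetric])
  have "left_annihilator {z * b} \<inter> I \<noteq> {0}" if I: "left_ideal I" "I \<noteq> {0}" for I
  proof -
    have "left_annihilator {z} \<inter> I \<noteq> {0}"
      using assms I unfolding essential_left_ideal_def by simp
    moreover have "0 \<in> left_annihilator {z} \<inter> I"
      using I(1) by (simp add: left_ideal_def left_annihilator_def)
    ultimately show ?thesis using sub by auto
  qed
  then show ?thesis
    using left_ideal_left_annihilator unfolding essential_left_ideal_def by simp
qed

lemma right_dischinger_if_left_goldie:
  assumes id: "has_identity TYPE('a::ring)" and G: "left_goldie TYPE('a)"
  shows "right_dischinger TYPE('a)"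
  unfolding right_dischinger_def
proof (intro allI impI)
  fix a :: 'a
  assume rsr: "right_strongly_regular a"
  then obtain x where a: "a = a * a * x" unfolding right_strongly_regular_def by blast
  obtain d where acc: "acc_left_annihilators TYPE('a)" and dim: "left_uniform_dim TYPE('a) d"
    using G unfolding left_goldie_def by blast
  have "essential_left_ideal (left_annihilator {test_seq a x i})" for i
    unfolding test_seq_def
    by (intro essential_left_annihilator_mult essential_left_annihilator_defect[OF id dim a])
  then obtain k where "nprod (test_seq a x) k = 0"
    using essential_annihilators_prod_zero[OF id acc] by blast
  then show "strongly_regular a"
    using rsr left_strongly_regular_if_test_prod_zero[OF a] unfolding strongly_regular_def by blast
qed

theorem corollary2p14:
  "((\<forall>T :: 'a::ring set. is_subring T \<and> nil_set T \<longrightarrow> nilpotent_set T)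
      \<longrightarrow> dischinger TYPE('a)) \<and>
   (has_identity TYPE('b::ring) \<and> left_goldie TYPE('b) \<longrightarrow> dischinger TYPE('b))"
  using dischinger_if_nil_subrings_nilpotent[where ?'a = 'a]
    right_dischinger_if_left_goldie[where ?'a = 'b]
    left_dischinger_if_acc_left_annihilators[where ?'a = 'b]
  unfolding dischinger_def left_goldie_def by blast

end
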